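(* Let $\mathbb{F}_q$ be a finite field, let $\mathrm{G}$ be a reductive algebraic group over $\mathbb{F}_q$ with Lie algebra $\mathfrak{g}$, let $\rho:\mathrm{G}\to \mathrm{GL}(\mathbb{V})$ be a representation on a finite-dimensional $\mathbb{F}_q$-vector space $\mathbb{V}$ with derivative $\varrho:\mathfrak{g}\to\mathfrak{gl}(\mathbb{V})$, and let $\mu:\mathbb{V}\times\mathbb{V}^*\to\mathfrak{g}^*$ be the moment map defined by $\langle\mu(v,w),X\rangle=\langle\varrho(X)v,w\rangle$ for all $X\in\mathfrak{g}$. Let $\xi\in(\mathfrak{g}^* )^{\mathrm{G}}$. Then the number of solutions of $\mu(v,w)=\xi$ over $\mathbb{F}_q$ is $$\#\{(v,w)\in\mathbb{V}\times\mathbb{V}^* \mid \mu(v,w)=\xi\}=|\mathfrak{g}|^{-1/2}\,|\mathbb{V}|\,\mathcal{F}(a_\varrho)(\xi)=|\mathfrak{g}|^{-1}\,|\mathbb{V}|\sum_{X\in\mathfrak{g}}a_\varrho(X)\,\Psi(\langle X,\xi\rangle).$$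
   Context: Here $\mathfrak{g}$ and $\mathbb{V}$ denote the finite sets (finite-dimensional vector spaces) of $\mathbb{F}_q$-points, $|S|$ is the number of elements of a finite set $S$, and $\langle\cdot,\cdot\rangle$ denotes the natural pairing between a vector space and its dual. The function $a_\varrho:\mathfrak{g}\to\mathbb{N}\subset\mathbb{C}$ is defined by $a_\varrho(X)=|\ker(\varrho(X))|$, where $\ker(\varrho(X))\subset\mathbb{V}$. Fix a non-trivial additive character $\Psi:\mathbb{F}_q\to\mathbb{C}^\times$. The Fourier transform $\mathcal{F}(f):\mathfrak{g}^*\to\mathbb{C}$ of a function $f:\mathfrak{g}\to\mathbb{C}$ is $$\mathcal{F}(f)(Y)=|\mathfrak{g}|^{-1/2}\sum_{X\in\mathfrak{g}}f(X)\,\Psi(\langle X,Y\rangle),\qquad Y\in\mathfrak{g}^*.$$ *)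

theory Defs
  imports
    "HOL-Analysis.Determinants"
    "HOL-Algebra.Coset"
    "HOL-Algebra.Algebraic_Closure_Type"
    "HOL-Library.Poly_Mapping"
    "HOL-Library.FuncSet"
begin

text \<open>
  Algebraic groups over a perfect field \<open>k\<close> (the type \<open>'a\<close>) are taken in the classical sense:
  with \<open>K = 'a alg_closure\<close>, such a group is the set \<open>G\<close> of \<open>K\<close>-points of a closed subgroup
  of \<open>GL\<^sub>n\<close> that is defined over \<open>k\<close>, i.e. cut out by regular functions with coefficients in \<open>k\<close>.
\<close>

section \<open>Regular functions on the general linear group\<close>

text \<open>
  The coordinate ring of \<open>GL\<^sub>n\<close> is generated by the matrix entries, indexed by \<open>Some (i, j)\<close>,
  and the inverse of the determinant, indexed by \<open>None\<close>.
\<close>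

type_synonym 'n gl_monomial = "('n \<times> 'n) option \<Rightarrow>\<^sub>0 nat"

definition gl_coords :: "'b::field^'n^'n \<Rightarrow> ('n \<times> 'n) option \<Rightarrow> 'b" where
  "gl_coords g = (\<lambda>x. case x of None \<Rightarrow> inverse (det g) | Some (i, j) \<Rightarrow> g $ i $ j)"

text \<open>
  The coordinates of the point \<open>1 + t A\<close> of \<open>GL\<^sub>n\<close> over the dual numbers, given by representatives
  modulo \<open>t\<^sup>2\<close>; note \<open>det (1 + t A) = 1 + t (trace A)\<close> modulo \<open>t\<^sup>2\<close>.
\<close>

definition gl_tangent_coords :: "'b::field^'n^'n \<Rightarrow> ('n \<times> 'n) option \<Rightarrow> 'b poly" where
  "gl_tangent_coords A =
     (\<lambda>x. case x of None \<Rightarrow> [:1, - trace A:] | Some (i, j) \<Rightarrow> [:(mat 1 :: 'b^'n^'n) $ i $ j, A $ i $ j:])"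

definition monomial_eval :: "('i \<Rightarrow>\<^sub>0 nat) \<Rightarrow> ('i \<Rightarrow> 'b::comm_semiring_1) \<Rightarrow> 'b" where
  "monomial_eval m x = (\<Prod>i\<in>Poly_Mapping.keys m. x i ^ Poly_Mapping.lookup m i)"

text \<open>
  Regular functions with values in a vector space \<open>'w\<close> with scalar multiplication \<open>s\<close>;
  the scalar-valued ones are the case \<open>s = (*)\<close>.  The value of \<open>reg_diff s p\<close> at \<open>A\<close> is the
  differential of \<open>p\<close> at the identity in direction \<open>A\<close>.
\<close>

definition reg_eval ::
    "('b::field \<Rightarrow> 'w::ab_group_add \<Rightarrow> 'w) \<Rightarrow> ('n gl_monomial \<Rightarrow>\<^sub>0 'w) \<Rightarrow> 'b^'n^'n \<Rightarrow> 'w" where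
  "reg_eval s p g =
     (\<Sum>m\<in>Poly_Mapping.keys p. s (monomial_eval m (gl_coords g)) (Poly_Mapping.lookup p m))"

definition reg_diff ::
    "('b::field \<Rightarrow> 'w::ab_group_add \<Rightarrow> 'w) \<Rightarrow> ('n gl_monomial \<Rightarrow>\<^sub>0 'w) \<Rightarrow> 'b^'n^'n \<Rightarrow> 'w" where
  "reg_diff s p A =
     (\<Sum>m\<in>Poly_Mapping.keys p.
        s (Polynomial.coeff (monomial_eval m (gl_tangent_coords A)) 1) (Poly_Mapping.lookup p m))"

section \<open>Linear algebraic groups\<close>

definition GL :: "('b::field^'n^'n) monoid" where
  "GL = \<lparr>carrier = {g. invertible g}, mult = (**), one = mat 1\<rparr>"

abbreviation GL_restrict :: "('b::field^'n^'n) set \<Rightarrow> ('b^'n^'n) monoid" where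
  "GL_restrict G \<equiv> GL\<lparr>carrier := G\<rparr>"

definition zariski_closed :: "('b::field^'n^'n) set \<Rightarrow> bool" where
  "zariski_closed Z \<longleftrightarrow>
     (\<exists>F :: ('n gl_monomial \<Rightarrow>\<^sub>0 'b) set. Z = {g. invertible g \<and> (\<forall>f\<in>F. reg_eval (*) f g = 0)})"

definition zariski_connected :: "('b::field^'n^'n) set \<Rightarrow> bool" where
  "zariski_connected Z \<longleftrightarrow>
     \<not> (\<exists>A B. zariski_closed A \<and> zariski_closed B \<and> A \<union> B = Z \<and> A \<inter> B = {} \<and> A \<noteq> {} \<and> B \<noteq> {})"

text \<open>The power operation of the type of matrices is entrywise, hence the explicit iteration.\<close>

definition unipotent :: "'b::field^'n^'n \<Rightarrow> bool" where
  "unipotent u \<longleftrightarrow> (\<exists>N. ((\<lambda>y. (u - mat 1) ** y) ^^ N) (mat 1) = 0)"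

definition closed_over_base :: "('a::field alg_closure^'n^'n) set \<Rightarrow> bool" where
  "closed_over_base Z \<longleftrightarrow>
     (\<exists>F :: ('n gl_monomial \<Rightarrow>\<^sub>0 'a) set.
        Z = {g. invertible g \<and> (\<forall>f\<in>F. reg_eval (*) (Poly_Mapping.map to_ac f) g = 0)})"

definition linear_algebraic_group :: "('a::field alg_closure^'n^'n) set \<Rightarrow> bool" where
  "linear_algebraic_group G \<longleftrightarrow> subgroup G GL \<and> closed_over_base G"

text \<open>Reductive means that the unipotent radical is trivial; connectedness is not required.\<close>

definition reductive_group :: "('a::field alg_closure^'n^'n) set \<Rightarrow> bool" where
  "reductive_group G \<longleftrightarrow>
     linear_algebraic_group G \<and>
     (\<forall>U. normal U (GL_restrict G) \<and> zariski_closed U \<and> zariski_connected U \<and> (\<forall>u\<in>U. unipotent u)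
        \<longrightarrow> U = {mat 1})"

section \<open>Lie algebra\<close>

definition vanishing_ideal :: "('b::field^'n^'n) set \<Rightarrow> ('n gl_monomial \<Rightarrow>\<^sub>0 'b) set" where
  "vanishing_ideal G = {f. \<forall>g\<in>G. reg_eval (*) f g = 0}"

definition vanishing_ideal_base ::
    "('a::field alg_closure^'n^'n) set \<Rightarrow> ('n gl_monomial \<Rightarrow>\<^sub>0 'a) set" where
  "vanishing_ideal_base G = {f. Poly_Mapping.map to_ac f \<in> vanishing_ideal G}"

definition tangent_space :: "('n gl_monomial \<Rightarrow>\<^sub>0 'b::field) set \<Rightarrow> ('b^'n^'n) set" where
  "tangent_space I = {A. \<forall>f\<in>I. reg_diff (*) f A = 0}"

text \<open>
  \<open>lie_algebra G\<close> is the Lie algebra over \<open>k\<close>, i.e. the set of \<open>k\<close>-points;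
  \<open>lie_algebra_closure G\<close> is the Lie algebra of the base change of \<open>G\<close> to \<open>K\<close>.
\<close>

definition lie_algebra :: "('a::field alg_closure^'n^'n) set \<Rightarrow> ('a^'n^'n) set" where
  "lie_algebra G = tangent_space (vanishing_ideal_base G)"

definition lie_algebra_closure ::
    "('a::field alg_closure^'n^'n) set \<Rightarrow> ('a alg_closure^'n^'n) set" where
  "lie_algebra_closure G = tangent_space (vanishing_ideal G)"

section \<open>Dual spaces and coadjoint invariants\<close>

definition matrix_scale :: "'b::field \<Rightarrow> 'b^'n^'m \<Rightarrow> 'b^'n^'m" where
  "matrix_scale c A = map_matrix (\<lambda>x. c * x) A"

text \<open>
  The dual of a subspace \<open>S\<close>.  Functionals are extensional, so that each element of the dual is
  represented exactly once; the pairing of \<open>x \<in> S\<close> with \<open>w\<close> is \<open>w x\<close>.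
\<close>

definition dual_space ::
    "('b::field \<Rightarrow> 'w::ab_group_add \<Rightarrow> 'w) \<Rightarrow> 'w set \<Rightarrow> ('w \<Rightarrow> 'b) set" where
  "dual_space s S =
     {w \<in> extensional S. (\<forall>x\<in>S. \<forall>y\<in>S. w (x + y) = w x + w y) \<and> (\<forall>c. \<forall>x\<in>S. w (s c x) = c * w x)}"

abbreviation lie_dual :: "('a::field alg_closure^'n^'n) set \<Rightarrow> ('a^'n^'n \<Rightarrow> 'a) set" where
  "lie_dual G \<equiv> dual_space matrix_scale (lie_algebra G)"

text \<open>
  Invariance under the algebraic group \<open>G\<close>, and not merely under its finite group of \<open>k\<close>-points:
  the \<open>K\<close>-linear extension \<open>\<eta>\<close> of \<open>\<xi>\<close> to the Lie algebra over \<open>K\<close> is fixed by all \<open>K\<close>-points.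
\<close>

definition coadjoint_invariants :: "('a::field alg_closure^'n^'n) set \<Rightarrow> ('a^'n^'n \<Rightarrow> 'a) set" where
  "coadjoint_invariants G =
     {\<xi> \<in> lie_dual G.
        \<exists>\<eta> \<in> dual_space matrix_scale (lie_algebra_closure G).
          (\<forall>A \<in> lie_algebra G. \<eta> (map_matrix to_ac A) = to_ac (\<xi> A)) \<and>
          (\<forall>g\<in>G. \<forall>A \<in> lie_algebra_closure G. \<eta> (g ** A ** matrix_inv g) = \<eta> A)}"

section \<open>Rational representations and their derivatives\<close>

abbreviation base_scale :: "('a::field alg_closure \<Rightarrow> 'w \<Rightarrow> 'w) \<Rightarrow> 'a \<Rightarrow> 'w \<Rightarrow> 'w" where
  "base_scale s \<equiv> (\<lambda>c. s (to_ac c))"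

text \<open>
  A finite-dimensional \<open>k\<close>-space \<open>V\<close> is given inside its base change \<open>'w = V \<otimes> K\<close>: a \<open>K\<close>-basis of
  the whole space is a \<open>k\<close>-basis of \<open>V\<close>.
\<close>

definition k_form :: "('a::field alg_closure \<Rightarrow> 'w::ab_group_add \<Rightarrow> 'w) \<Rightarrow> 'w set \<Rightarrow> bool" where
  "k_form s V \<longleftrightarrow>
     vector_space s \<and>
     (\<exists>B. finite B \<and> \<not> module.dependent s B \<and> module.span s B = UNIV \<and>
          V = module.span (base_scale s) B)"

definition GL_space :: "('b::field \<Rightarrow> 'w::ab_group_add \<Rightarrow> 'w) \<Rightarrow> ('w \<Rightarrow> 'w) monoid" where
  "GL_space s = \<lparr>carrier = {f. Vector_Spaces.linear s s f \<and> bij f}, mult = (\<circ>), one = id\<rparr>"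

text \<open>\<open>f\<close> is the restriction to \<open>G\<close> of the regular function \<open>p\<close>, which is defined over \<open>k\<close>.\<close>

definition regular_over_base ::
    "('a::field alg_closure \<Rightarrow> 'w::ab_group_add \<Rightarrow> 'w) \<Rightarrow> 'w set \<Rightarrow> ('a alg_closure^'n^'n) set \<Rightarrow>
     ('n gl_monomial \<Rightarrow>\<^sub>0 'w) \<Rightarrow> ('a alg_closure^'n^'n \<Rightarrow> 'w) \<Rightarrow> bool" where
  "regular_over_base s V G p f \<longleftrightarrow>
     (\<forall>m. Poly_Mapping.lookup p m \<in> V) \<and> (\<forall>g\<in>G. f g = reg_eval s p g)"

text \<open>
  A homomorphism of algebraic groups over \<open>k\<close> from \<open>G\<close> to \<open>GL(V)\<close>: its matrix coefficients are
  regular functions on \<open>G\<close> defined over \<open>k\<close>.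
\<close>

definition rational_representation ::
    "('a::field alg_closure \<Rightarrow> 'w::ab_group_add \<Rightarrow> 'w) \<Rightarrow> 'w set \<Rightarrow> ('a alg_closure^'n^'n) set \<Rightarrow>
     ('a alg_closure^'n^'n \<Rightarrow> 'w \<Rightarrow> 'w) \<Rightarrow> bool" where
  "rational_representation s V G \<rho> \<longleftrightarrow>
     \<rho> \<in> hom (GL_restrict G) (GL_space s) \<and>
     (\<forall>v\<in>V. \<exists>p. regular_over_base s V G p (\<lambda>g. \<rho> g v))"

text \<open>
  For \<open>A \<in> lie_algebra G\<close> and \<open>v \<in> V\<close>, the differential at the identity of \<open>g \<mapsto> \<rho> g v\<close> in
  direction \<open>A\<close>; it does not depend on the regular function \<open>p\<close> extending this map.
\<close>

definition rep_derivative ::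
    "('a::field alg_closure \<Rightarrow> 'w::ab_group_add \<Rightarrow> 'w) \<Rightarrow> 'w set \<Rightarrow> ('a alg_closure^'n^'n) set \<Rightarrow>
     ('a alg_closure^'n^'n \<Rightarrow> 'w \<Rightarrow> 'w) \<Rightarrow> 'a^'n^'n \<Rightarrow> 'w \<Rightarrow> 'w" where
  "rep_derivative s V G \<rho> A v =
     (THE u. \<exists>p. regular_over_base s V G p (\<lambda>g. \<rho> g v) \<and> u = reg_diff (base_scale s) p A)"

section \<open>Moment map and Fourier transform\<close>

text \<open>In the following two definitions \<open>L\<close> is the Lie algebra and \<open>\<phi>\<close> its action on \<open>V\<close>.\<close>

definition moment_map :: "'g set \<Rightarrow> ('g \<Rightarrow> 'w \<Rightarrow> 'w) \<Rightarrow> 'w \<Rightarrow> ('w \<Rightarrow> 'a) \<Rightarrow> 'g \<Rightarrow> 'a" where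
  "moment_map L \<phi> v w = (\<lambda>A\<in>L. w (\<phi> A v))"

definition kernel_count :: "'w::zero set \<Rightarrow> ('g \<Rightarrow> 'w \<Rightarrow> 'w) \<Rightarrow> 'g \<Rightarrow> nat" where
  "kernel_count V \<phi> A = card {v \<in> V. \<phi> A v = 0}"

definition nontrivial_additive_character :: "('a::field \<Rightarrow> complex) \<Rightarrow> bool" where
  "nontrivial_additive_character \<Psi> \<longleftrightarrow>
     (\<forall>x. \<Psi> x \<noteq> 0) \<and> (\<forall>x y. \<Psi> (x + y) = \<Psi> x * \<Psi> y) \<and> (\<exists>x. \<Psi> x \<noteq> 1)"

definition fourier_transform ::
    "('a \<Rightarrow> complex) \<Rightarrow> 'g set \<Rightarrow> ('g \<Rightarrow> complex) \<Rightarrow> ('g \<Rightarrow> 'a) \<Rightarrow> complex" where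
  "fourier_transform \<Psi> L f Y =
     complex_of_real (real (card L) powr (- 1 / 2)) * (\<Sum>A\<in>L. f A * \<Psi> (Y A))"

end

theory Submission
  imports Defs
begin

text \<open>
  For fixed \<open>v\<close> and \<open>w\<close>, orthogonality of characters on \<open>\<gg>\<close> expresses the indicator of
  \<open>\<mu>(v, w) = \<xi>\<close> as the mean over \<open>A \<in> \<gg>\<close> of \<open>\<Psi>(\<xi> A - w (\<phi> A v))\<close>.  Summing over \<open>w\<close> first and using
  orthogonality on the dual of \<open>V\<close> leaves \<open>|V|\<close> times the number of \<open>v\<close> with \<open>\<phi> A v = 0\<close>.
  This only needs that \<open>\<phi> A v\<close> lies in \<open>V\<close> and is linear in \<open>A\<close>.  The differential of the
  representation has this property because it can be computed from any regular extension: two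
  extensions differ by a function all of whose coordinates lie in the vanishing ideal over \<open>k\<close>.
\<close>

section \<open>Character sums\<close>

text \<open>Reindexing by \<open>\<tau>\<close> preserves the sum but also multiplies it by
  \<open>c\<close>, so \<open>(1 - c) * sum f S = 0\<close> in a domain.\<close>

lemma sum_eq_0_of_twisted_bij:
  fixes f :: "'x \<Rightarrow> 'c::idom"
  assumes "bij_betw \<tau> S S" "\<And>x. x \<in> S \<Longrightarrow> f (\<tau> x) = c * f x" "c \<noteq> 1"
  shows "sum f S = 0"
proof -
  have "sum f S = (\<Sum>x\<in>S. f (\<tau> x))"
    by (rule sum.reindex_bij_betw[OF assms(1), symmetric])
  also have "\<dots> = c * sum f S"
    by (simp add: assms(2) sum_distrib_left)
  finally show ?thesis using assms(3) by (simp add: mult_cancel_right1 flip: left_diff_distrib)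
qed

lemma nontrivial_additive_character_0:
  assumes "nontrivial_additive_character \<Psi>"
  shows "\<Psi> 0 = 1"
proof -
  have "\<Psi> (0 + 0) = \<Psi> 0 * \<Psi> 0" "\<Psi> 0 \<noteq> 0"
    using assms unfolding nontrivial_additive_character_def by blast+
  then show ?thesis by simp
qed

lemma nontrivial_additive_character_uminus:
  assumes "nontrivial_additive_character \<Psi>"
  shows "nontrivial_additive_character (\<lambda>x. \<Psi> (- x))"
proof -
  obtain x where "\<Psi> x \<noteq> 1"
    using assms unfolding nontrivial_additive_character_def by blast
  then have "\<Psi> (- (- x)) \<noteq> 1" by simp
  moreover have "\<Psi> (- (x + y)) = \<Psi> (- x) * \<Psi> (- y)" for x y
  proof -
    have "\<Psi> (- x + - y) = \<Psi> (- x) * \<Psi> (- y)"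
      using assms unfolding nontrivial_additive_character_def by blast
    then show ?thesis by simp
  qed
  ultimately show ?thesis
    using assms unfolding nontrivial_additive_character_def by blast
qed

text \<open>Orthogonality: a nonzero functional takes every value in the field, so
  \<open>\<Psi>\<close> composed with it is a nontrivial character of \<open>S\<close>. The
  functional is any function linear on \<open>S\<close>, so that expressions such as
  \<open>\<lambda>A. \<xi> A - w (\<phi> A v)\<close> can be inserted directly.\<close>

lemma sum_character_functional:
  assumes \<Psi>: "nontrivial_additive_character \<Psi>"
    and s: "vector_space s" and S: "module.subspace s S"
    and add: "\<And>x y. x \<in> S \<Longrightarrow> y \<in> S \<Longrightarrow> w (x + y) = w x + w y"
    and scale: "\<And>c x. x \<in> S \<Longrightarrow> w (s c x) = c * w x"
  shows "(\<Sum>x\<in>S. \<Psi> (w x)) = (if \<forall>x\<in>S. w x = 0 then of_nat (card S) else 0)"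
proof (cases "\<forall>x\<in>S. w x = 0")
  case True
  then show ?thesis by (simp add: nontrivial_additive_character_0[OF \<Psi>])
next
  case False
  interpret vector_space s by (rule s)
  obtain x where x: "x \<in> S" "w x \<noteq> 0" using False by blast
  obtain a where a: "\<Psi> a \<noteq> 1"
    using \<Psi> unfolding nontrivial_additive_character_def by blast
  \<comment> \<open>\<open>x\<close> is rescaled to make \<open>w y = a\<close>; translating
    \<open>S\<close> by \<open>y\<close> then multiplies each summand by
    \<open>\<Psi> a\<close>.\<close>
  define y where "y = s (a / w x) x"
  have y: "y \<in> S" unfolding y_def using x(1) S by (rule subspace_scale[rotated])
  have wy: "w y = a" unfolding y_def using x by (simp add: scale)
  have "bij_betw ((+) y) S S"
    by (rule bij_betw_byWitness[where f' = "\<lambda>z. z - y"])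
       (use y S in \<open>auto intro: subspace_add subspace_diff\<close>)
  moreover have "\<Psi> (w (y + z)) = \<Psi> a * \<Psi> (w z)" if "z \<in> S" for z
    using \<Psi> y that by (simp add: add wy nontrivial_additive_character_def)
  ultimately have "(\<Sum>x\<in>S. \<Psi> (w x)) = 0"
    using a by (intro sum_eq_0_of_twisted_bij)
  then show ?thesis by (simp only: False if_False)
qed

section \<open>Dual spaces\<close>

lemma dual_spaceD:
  assumes "w \<in> dual_space s S"
  shows "w \<in> extensional S"
    and "x \<in> S \<Longrightarrow> y \<in> S \<Longrightarrow> w (x + y) = w x + w y"
    and "x \<in> S \<Longrightarrow> w (s c x) = c * w x"
  using assms unfolding dual_space_def by blast+

lemma restrict_in_dual_space:
  assumes "vector_space s" "module.subspace s S"
    and "\<And>x y. x \<in> S \<Longrightarrow> y \<in> S \<Longrightarrow> f (x + y) = f x + f y"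
    and "\<And>c x. x \<in> S \<Longrightarrow> f (s c x) = c * f x"
  shows "restrict f S \<in> dual_space s S"
proof -
  interpret vector_space s by fact
  show ?thesis
    using assms(2-) by (auto simp: dual_space_def subspace_add subspace_scale)
qed

lemma finite_dual_space:
  fixes s :: "'b::{field,finite} \<Rightarrow> 'w::ab_group_add \<Rightarrow> 'w"
  assumes "finite S"
  shows "finite (dual_space s S)"
proof (rule finite_subset)
  show "dual_space s S \<subseteq> S \<rightarrow>\<^sub>E UNIV"
    by (auto simp: dual_space_def PiE_def)
  show "finite (S \<rightarrow>\<^sub>E (UNIV :: 'b set))"
    using assms by (intro finite_PiE) auto
qed

lemma finite_span_finite_field:
  fixes s :: "'b::{field,finite} \<Rightarrow> 'w::ab_group_add \<Rightarrow> 'w"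
  assumes "vector_space s" "finite B"
  shows "finite (module.span s B)"
proof -
  interpret vector_space s by fact
  have "span B \<subseteq> (\<lambda>u. \<Sum>v\<in>B. s (u v) v) ` (B \<rightarrow>\<^sub>E UNIV)"
  proof
    fix x assume "x \<in> span B"
    then obtain u where u: "x = (\<Sum>v\<in>B. s (u v) v)"
      unfolding span_finite[OF assms(2)] by blast
    show "x \<in> (\<lambda>u. \<Sum>v\<in>B. s (u v) v) ` (B \<rightarrow>\<^sub>E UNIV)"
    proof (rule image_eqI)
      \<comment> \<open>Coefficients are cut off outside \<open>B\<close>: the extensional families
        are finitely many even if the type of vectors is infinite.\<close>
      show "x = (\<Sum>v\<in>B. s (restrict u B v) v)"
        unfolding u by (rule sum.cong) simp_all
      show "restrict u B \<in> B \<rightarrow>\<^sub>E UNIV" by simp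
    qed
  qed
  then show ?thesis
    by (rule finite_subset) (intro finite_imageI finite_PiE assms(2) finite)
qed

text \<open>A nonzero vector has a nonzero coordinate with respect to \<open>B\<close>, and a
  multiple of that coordinate functional takes the prescribed value.\<close>

lemma dual_space_separates:
  assumes "vector_space s" "\<not> module.dependent s B"
    and u: "u \<in> module.span s B" "u \<noteq> 0"
  obtains w where "w \<in> dual_space s (module.span s B)" "w u = a"
proof -
  interpret vector_space s by fact
  have "\<exists>b. representation B u b \<noteq> 0"
  proof (rule ccontr)
    assume "\<nexists>b. representation B u b \<noteq> 0"
    then show False
      using sum_nonzero_representation_eq[OF assms(2) u(1)] u(2) by simp
  qed
  then obtain b where b: "representation B u b \<noteq> 0" by blast
  define d where "d = a / representation B u b"
  have "restrict (\<lambda>x. d * representation B x b) (span B) \<in> dual_space s (span B)"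
    by (rule restrict_in_dual_space[OF assms(1) subspace_span])
       (simp_all add: representation_add[OF assms(2)] representation_scale[OF assms(2)] distrib_left mult.left_commute)
  moreover have "restrict (\<lambda>x. d * representation B x b) (span B) u = a"
    using u b by (simp add: d_def)
  ultimately show ?thesis by (rule that)
qed

text \<open>The dual orthogonality, with evaluation at \<open>u\<close> as the functional. The
  translation is built by hand, with a restriction: extensional functions are
  \<open>undefined\<close> off the span and so need not be closed under pointwise addition.\<close>

lemma sum_character_dual_space:
  assumes \<Psi>: "nontrivial_additive_character \<Psi>"
    and s: "vector_space s" and B: "\<not> module.dependent s B"
    and u: "u \<in> module.span s B"
  shows "(\<Sum>w\<in>dual_space s (module.span s B). \<Psi> (w u)) =
    (if u = 0 then of_nat (card (dual_space s (module.span s B))) else 0)"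
proof (cases "u = 0")
  case True
  interpret vector_space s by (rule s)
  have "\<Psi> (w u) = 1" if "w \<in> dual_space s (span B)" for w
    using dual_spaceD(3)[OF that span_zero, of 0] True nontrivial_additive_character_0[OF \<Psi>] by simp
  then have "(\<Sum>w\<in>dual_space s (span B). \<Psi> (w u)) = (\<Sum>w\<in>dual_space s (span B). 1)"
    by (intro sum.cong) auto
  then show ?thesis using True by simp
next
  case False
  interpret vector_space s by (rule s)
  let ?D = "dual_space s (span B)"
  obtain a where a: "\<Psi> a \<noteq> 1"
    using \<Psi> unfolding nontrivial_additive_character_def by blast
  obtain w1 where w1: "w1 \<in> ?D" "w1 u = a"
    using dual_space_separates[OF s B u False] by blast
  \<comment> \<open>The factor \<open>c\<close> will be 1 for the translation and -1 for its
    inverse.\<close>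
  have mem: "restrict (\<lambda>x. w x + c * w1 x) (span B) \<in> ?D" if "w \<in> ?D" for w c
    by (rule restrict_in_dual_space[OF s subspace_span])
       (use dual_spaceD[OF w1(1)] dual_spaceD[OF that] in \<open>simp_all add: algebra_simps\<close>)
  have mem': "restrict (\<lambda>x. w x + w1 x) (span B) \<in> ?D"
    "restrict (\<lambda>x. w x - w1 x) (span B) \<in> ?D" if "w \<in> ?D" for w
    using mem[OF that, of 1] mem[OF that, of "- 1"] by simp_all
  \<comment> \<open>Off the span both round trips return \<open>undefined\<close>, which has to be
    the value of \<open>w\<close> there.\<close>
  have ext: "w x = undefined" if "w \<in> ?D" "x \<notin> span B" for w x
    using dual_spaceD(1)[OF that(1)] that(2) by (rule extensional_arb)
  have "bij_betw (\<lambda>w. restrict (\<lambda>x. w x + w1 x) (span B)) ?D ?D"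
    by (rule bij_betw_byWitness[where f' = "\<lambda>w. restrict (\<lambda>x. w x - w1 x) (span B)"])
       (use mem' in \<open>auto simp: restrict_def fun_eq_iff intro: ext[symmetric]\<close>)
  moreover have "\<Psi> (restrict (\<lambda>x. w x + w1 x) (span B) u) = \<Psi> a * \<Psi> (w u)" for w
    using \<Psi> u w1(2) by (simp add: nontrivial_additive_character_def)
  ultimately have "(\<Sum>w\<in>?D. \<Psi> (w u)) = 0"
    using a by (intro sum_eq_0_of_twisted_bij)
  then show ?thesis by (simp only: False if_False)
qed

text \<open>Both cardinalities equal the sum of \<open>\<Psi> (w x)\<close> over all pairs.\<close>

lemma card_dual_space:
  fixes s :: "'b::{field,finite} \<Rightarrow> 'w::ab_group_add \<Rightarrow> 'w"
  assumes \<Psi>: "nontrivial_additive_character (\<Psi> :: 'b \<Rightarrow> complex)"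
    and s: "vector_space s" and B: "finite B" "\<not> module.dependent s B"
  shows "card (dual_space s (module.span s B)) = card (module.span s B)"
proof -
  interpret vector_space s by (rule s)
  let ?V = "span B"
  let ?D = "dual_space s ?V"
  have fin: "finite ?V" "finite ?D"
    using finite_span_finite_field[OF s B(1)] finite_dual_space by blast+
  let ?z = "restrict (\<lambda>x. 0) ?V"
  have z: "?z \<in> ?D"
    by (rule restrict_in_dual_space[OF s subspace_span]) simp_all
  \<comment> \<open>By extensionality a single functional vanishes on the span, so summing over
    \<open>x\<close> first leaves one nonzero term.\<close>
  have zero: "(\<forall>x\<in>?V. w x = 0) \<longleftrightarrow> w = ?z" if "w \<in> ?D" for w
    using extensionalityI[OF dual_spaceD(1)[OF that], of ?z] by auto
  have "of_nat (card ?D) = (\<Sum>x\<in>?V. if x = 0 then of_nat (card ?D) else (0::complex))"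
    using fin span_zero by simp
  also have "\<dots> = (\<Sum>x\<in>?V. \<Sum>w\<in>?D. \<Psi> (w x))"
    using sum_character_dual_space[OF \<Psi> s B(2)] by (intro sum.cong) simp_all
  also have "\<dots> = (\<Sum>w\<in>?D. \<Sum>x\<in>?V. \<Psi> (w x))"
    by (rule sum.swap)
  also have "\<dots> = (\<Sum>w\<in>?D. if w = ?z then of_nat (card ?V) else 0)"
  proof (rule sum.cong[OF refl])
    fix w assume w: "w \<in> ?D"
    show "(\<Sum>x\<in>?V. \<Psi> (w x)) = (if w = ?z then of_nat (card ?V) else 0)"
      unfolding zero[OF w, symmetric]
      by (rule sum_character_functional[OF \<Psi> s subspace_span])
         (use dual_spaceD[OF w] in auto)
  qed
  also have "\<dots> = of_nat (card ?V)"
    using fin z by simp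
  finally show ?thesis by (simp only: of_nat_eq_iff)
qed

section \<open>Counting the fibre of a moment map\<close>

lemma card_moment_map_fibre:
  fixes s :: "'b::{field,finite} \<Rightarrow> 'w::ab_group_add \<Rightarrow> 'w"
    and t :: "'b \<Rightarrow> 'g::ab_group_add \<Rightarrow> 'g"
  assumes \<Psi>: "nontrivial_additive_character \<Psi>"
    and s: "vector_space s" and B: "finite B" "\<not> module.dependent s B"
    and V: "V = module.span s B"
    and t: "vector_space t" and L: "module.subspace t L" "finite L"
    and mem: "\<And>A v. A \<in> L \<Longrightarrow> v \<in> V \<Longrightarrow> \<phi> A v \<in> V"
    and add: "\<And>A A' v. A \<in> L \<Longrightarrow> A' \<in> L \<Longrightarrow> v \<in> V \<Longrightarrow> \<phi> (A + A') v = \<phi> A v + \<phi> A' v"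
    and scale: "\<And>c A v. A \<in> L \<Longrightarrow> v \<in> V \<Longrightarrow> \<phi> (t c A) v = s c (\<phi> A v)"
    and \<xi>: "\<xi> \<in> dual_space t L"
  shows "of_nat (card {(v, w). v \<in> V \<and> w \<in> dual_space s V \<and> moment_map L \<phi> v w = \<xi>}) =
    inverse (of_nat (card L)) * of_nat (card V) *
      (\<Sum>A\<in>L. of_nat (kernel_count V \<phi> A) * \<Psi> (\<xi> A))"
proof -
  let ?D = "dual_space s V"
  let ?F = "{(v, w). v \<in> V \<and> w \<in> ?D \<and> moment_map L \<phi> v w = \<xi>}"
  interpret T: vector_space t by (rule t)
  have finV: "finite V" using finite_span_finite_field[OF s B(1)] V by simp
  have finD: "finite ?D" using finite_dual_space[OF finV] .
  have "L \<noteq> {}" using T.subspace_0[OF L(1)] by blast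
  then have L0: "of_nat (card L) \<noteq> (0::complex)" using L(2) by simp
  \<comment> \<open>Both sides of the fibre equation are extensional on \<open>L\<close>, so it says
    exactly that \<open>\<lambda>A. \<xi> A - w (\<phi> A v)\<close> vanishes on
    \<open>L\<close>.\<close>
  have inner: "(\<Sum>A\<in>L. \<Psi> (\<xi> A - w (\<phi> A v))) =
      (if moment_map L \<phi> v w = \<xi> then of_nat (card L) else 0)" if vw: "v \<in> V" "w \<in> ?D" for v w
  proof -
    have "(\<forall>A\<in>L. \<xi> A - w (\<phi> A v) = 0) \<longleftrightarrow> moment_map L \<phi> v w = \<xi>"
      using extensionalityI[OF dual_spaceD(1)[OF \<xi>], of "moment_map L \<phi> v w"]
      by (auto simp: moment_map_def)
    moreover have "(\<Sum>A\<in>L. \<Psi> (\<xi> A - w (\<phi> A v))) =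
        (if \<forall>A\<in>L. \<xi> A - w (\<phi> A v) = 0 then of_nat (card L) else 0)"
      by (rule sum_character_functional[OF \<Psi> t L(1)])
         (use vw dual_spaceD[OF \<xi>] dual_spaceD[OF vw(2)] in
           \<open>simp_all add: mem add scale algebra_simps\<close>)
    ultimately show ?thesis by simp
  qed
  \<comment> \<open>\<open>\<Psi> (\<xi> A)\<close> is constant in \<open>w\<close>; what remains is
    a sum of the inverse character \<open>\<lambda>x. \<Psi> (- x)\<close>, again nontrivial, over a
    dual with as many elements as \<open>V\<close>.\<close>
  have outer: "(\<Sum>w\<in>?D. \<Psi> (\<xi> A - w (\<phi> A v))) =
      (if \<phi> A v = 0 then of_nat (card V) * \<Psi> (\<xi> A) else 0)" if "A \<in> L" "v \<in> V" for A v
  proof -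
    have "\<Psi> (x - y) = \<Psi> x * \<Psi> (- y)" for x y
      using \<Psi> unfolding nontrivial_additive_character_def by (metis diff_conv_add_uminus)
    then have "(\<Sum>w\<in>?D. \<Psi> (\<xi> A - w (\<phi> A v))) = \<Psi> (\<xi> A) * (\<Sum>w\<in>?D. \<Psi> (- w (\<phi> A v)))"
      by (simp add: sum_distrib_left)
    also have "(\<Sum>w\<in>?D. \<Psi> (- w (\<phi> A v))) = (if \<phi> A v = 0 then of_nat (card ?D) else 0)"
      using sum_character_dual_space[OF nontrivial_additive_character_uminus[OF \<Psi>] s B(2)]
        mem[OF that] by (simp add: V)
    finally show ?thesis
      using card_dual_space[OF \<Psi> s B] by (simp add: V)
  qed
  have "finite (V \<times> ?D)" using finV finD by simp
  have "of_nat (card L) * of_nat (card ?F) = (\<Sum>p\<in>?F. of_nat (card L) :: complex)"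
    by simp
  also have "\<dots> = (\<Sum>p\<in>V \<times> ?D. if moment_map L \<phi> (fst p) (snd p) = \<xi> then of_nat (card L) else 0)"
    by (rule sum.mono_neutral_cong_left[OF \<open>finite (V \<times> ?D)\<close>]) auto
  also have "\<dots> = (\<Sum>v\<in>V. \<Sum>w\<in>?D. if moment_map L \<phi> v w = \<xi> then of_nat (card L) else 0)"
    by (simp add: sum.cartesian_product split_beta)
  also have "\<dots> = (\<Sum>v\<in>V. \<Sum>w\<in>?D. \<Sum>A\<in>L. \<Psi> (\<xi> A - w (\<phi> A v)))"
    by (intro sum.cong refl) (simp add: inner)
  also have "\<dots> = (\<Sum>v\<in>V. \<Sum>A\<in>L. \<Sum>w\<in>?D. \<Psi> (\<xi> A - w (\<phi> A v)))"
    by (intro sum.cong refl sum.swap)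
  also have "\<dots> = (\<Sum>A\<in>L. \<Sum>v\<in>V. \<Sum>w\<in>?D. \<Psi> (\<xi> A - w (\<phi> A v)))"
    by (rule sum.swap)
  also have "\<dots> = (\<Sum>A\<in>L. \<Sum>v\<in>V. if \<phi> A v = 0 then of_nat (card V) * \<Psi> (\<xi> A) else 0)"
    by (intro sum.cong refl) (simp add: outer)
  also have "\<dots> = of_nat (card V) * (\<Sum>A\<in>L. of_nat (kernel_count V \<phi> A) * \<Psi> (\<xi> A))"
    unfolding sum_distrib_left kernel_count_def
    by (intro sum.cong refl) (simp add: finV flip: sum.inter_filter)
  finally show ?thesis using L0 by (simp add: field_simps)
qed

section \<open>Differentials of regular functions\<close>

text \<open>Common form of \<open>reg_eval\<close> and \<open>reg_diff\<close>, which differ only in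
  the scalar weight of each monomial; additivity and naturality in the coefficients are thus proved
  once for both.\<close>

definition coeff_sum :: "('b \<Rightarrow> 'w \<Rightarrow> 'w) \<Rightarrow> ('m \<Rightarrow> 'b) \<Rightarrow> ('m \<Rightarrow>\<^sub>0 'w::ab_group_add) \<Rightarrow> 'w" where
  "coeff_sum s c p = (\<Sum>m\<in>Poly_Mapping.keys p. s (c m) (Poly_Mapping.lookup p m))"

lemma reg_eval_eq_coeff_sum:
  "reg_eval s p g = coeff_sum s (\<lambda>m. monomial_eval m (gl_coords g)) p"
  by (simp add: reg_eval_def coeff_sum_def)

lemma reg_diff_eq_coeff_sum:
  "reg_diff s p A = coeff_sum s (\<lambda>m. Polynomial.coeff (monomial_eval m (gl_tangent_coords A)) 1) p"
  by (simp add: reg_diff_def coeff_sum_def)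

text \<open>Adding or mapping coefficients can shrink the set of keys; this allows a common index
  set.\<close>

lemma coeff_sum_superset:
  assumes "\<And>c. s c 0 = 0" "finite M" "Poly_Mapping.keys p \<subseteq> M"
  shows "coeff_sum s c p = (\<Sum>m\<in>M. s (c m) (Poly_Mapping.lookup p m))"
  unfolding coeff_sum_def
  by (rule sum.mono_neutral_left) (use assms in \<open>auto simp: in_keys_iff\<close>)

lemma coeff_sum_add:
  assumes "\<And>c. s c 0 = 0" "\<And>c x y. s c (x + y) = s c x + s c y"
  shows "coeff_sum s c (p + q) = coeff_sum s c p + coeff_sum s c q"
proof -
  let ?M = "Poly_Mapping.keys p \<union> Poly_Mapping.keys q"
  have "coeff_sum s c (p + q) = (\<Sum>m\<in>?M. s (c m) (Poly_Mapping.lookup (p + q) m))"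
    using assms(1) by (intro coeff_sum_superset keys_add) auto
  also have "\<dots> = (\<Sum>m\<in>?M. s (c m) (Poly_Mapping.lookup p m)) + (\<Sum>m\<in>?M. s (c m) (Poly_Mapping.lookup q m))"
    by (simp add: lookup_add assms(2) sum.distrib)
  also have "\<dots> = coeff_sum s c p + coeff_sum s c q"
    using assms(1) by (simp add: coeff_sum_superset[of s ?M])
  finally show ?thesis .
qed

text \<open>Change of coefficients with the weights kept fixed, used both for coordinate functionals
  and for the embedding \<open>to_ac\<close>.\<close>

lemma coeff_sum_map:
  fixes s :: "'b \<Rightarrow> 'w::ab_group_add \<Rightarrow> 'w" and t :: "'b \<Rightarrow> 'u::ab_group_add \<Rightarrow> 'u"
    and c :: "'c \<Rightarrow> 'b"
  assumes h: "\<And>x y. h (x + y) = h x + h y" "\<And>c x. h (s c x) = t c (h x)"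
    and t: "\<And>c. t c 0 = 0"
  shows "coeff_sum t c (Poly_Mapping.map h p) = h (coeff_sum s c p)"
proof -
  have h0: "h 0 = 0" using h(1)[of 0 0] by simp
  have h_sum: "h (sum f M) = (\<Sum>m\<in>M. h (f m))" for f :: "'c \<Rightarrow> 'w" and M
    by (induction M rule: infinite_finite_induct) (simp_all add: h0 h(1))
  have "Poly_Mapping.keys (Poly_Mapping.map h p) \<subseteq> Poly_Mapping.keys p"
    by (auto simp: in_keys_iff map.rep_eq)
  then have "coeff_sum t c (Poly_Mapping.map h p) =
      (\<Sum>m\<in>Poly_Mapping.keys p. t (c m) (Poly_Mapping.lookup (Poly_Mapping.map h p) m))"
    by (intro coeff_sum_superset t) auto
  also have "\<dots> = (\<Sum>m\<in>Poly_Mapping.keys p. h (s (c m) (Poly_Mapping.lookup p m)))"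
    by (intro sum.cong refl) (simp add: map.rep_eq h(2) in_keys_iff when_def)
  also have "\<dots> = h (coeff_sum s c p)"
    by (simp add: coeff_sum_def h_sum)
  finally show ?thesis .
qed

text \<open>
  Polynomials stand for dual numbers, i.e. tangent vectors at the point given by the constant term;
  stated as a relation, linear combination of tangent vectors is compatible with products.
\<close>

definition dual_number_comb :: "'b::comm_ring_1 \<Rightarrow> 'b \<Rightarrow> 'b poly \<Rightarrow> 'b poly \<Rightarrow> 'b poly \<Rightarrow> bool" where
  "dual_number_comb \<alpha> \<beta> x y z \<longleftrightarrow>
     Polynomial.coeff x 0 = Polynomial.coeff z 0 \<and> Polynomial.coeff y 0 = Polynomial.coeff z 0 \<and>
     Polynomial.coeff z 1 = \<alpha> * Polynomial.coeff x 1 + \<beta> * Polynomial.coeff y 1"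

lemma dual_number_comb_1: "dual_number_comb \<alpha> \<beta> 1 1 1"
  by (simp add: dual_number_comb_def)

text \<open>Leibniz rule: the first-order coefficient of a product is linear in those of the factors
  once the constant terms agree.\<close>

lemma dual_number_comb_mult:
  assumes "dual_number_comb \<alpha> \<beta> x y z" "dual_number_comb \<alpha> \<beta> x' y' z'"
  shows "dual_number_comb \<alpha> \<beta> (x * x') (y * y') (z * z')"
  using assms by (simp add: dual_number_comb_def coeff_mult algebra_simps)

lemma dual_number_comb_power:
  assumes "dual_number_comb \<alpha> \<beta> x y z"
  shows "dual_number_comb \<alpha> \<beta> (x ^ n) (y ^ n) (z ^ n)"
  by (induction n) (simp_all add: dual_number_comb_1 dual_number_comb_mult assms)

lemma dual_number_comb_prod:
  assumes "\<And>i. i \<in> I \<Longrightarrow> dual_number_comb \<alpha> \<beta> (x i) (y i) (z i)"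
  shows "dual_number_comb \<alpha> \<beta> (prod x I) (prod y I) (prod z I)"
  using assms
  by (induction I rule: infinite_finite_induct) (simp_all add: dual_number_comb_1 dual_number_comb_mult)

text \<open>Every tangent vector here is based at the identity, so the constant terms do not depend
  on the matrix, and the first-order terms are entries or minus the trace.\<close>

lemma dual_number_comb_gl_tangent_coords:
  fixes A A' :: "'b::field^'n^'n"
  shows "dual_number_comb \<alpha> \<beta> (gl_tangent_coords A i) (gl_tangent_coords A' i)
    (gl_tangent_coords (matrix_scale \<alpha> A + matrix_scale \<beta> A') i)"
  by (auto simp: dual_number_comb_def gl_tangent_coords_def matrix_scale_def trace_def
      sum.distrib sum_distrib_left algebra_simps split: option.splits)

lemma reg_diff_linear:
  fixes A A' :: "'b::field^'n^'n"
  assumes "vector_space s"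
  shows "reg_diff s p (matrix_scale \<alpha> A + matrix_scale \<beta> A') =
    s \<alpha> (reg_diff s p A) + s \<beta> (reg_diff s p A')"
proof -
  interpret vector_space s by fact
  have "dual_number_comb \<alpha> \<beta> (monomial_eval m (gl_tangent_coords A)) (monomial_eval m (gl_tangent_coords A'))
      (monomial_eval m (gl_tangent_coords (matrix_scale \<alpha> A + matrix_scale \<beta> A')))" for m
    unfolding monomial_eval_def
    by (intro dual_number_comb_prod dual_number_comb_power dual_number_comb_gl_tangent_coords)
  then have "Polynomial.coeff (monomial_eval m (gl_tangent_coords (matrix_scale \<alpha> A + matrix_scale \<beta> A'))) 1 =
      \<alpha> * Polynomial.coeff (monomial_eval m (gl_tangent_coords A)) 1 +
      \<beta> * Polynomial.coeff (monomial_eval m (gl_tangent_coords A')) 1" for m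
    unfolding dual_number_comb_def by blast
  then show ?thesis
    by (simp add: reg_diff_def scale_left_distrib scale_sum_right sum.distrib)
qed

section \<open>Lie algebras and derivatives of representations\<close>

lemma vector_space_mult: "vector_space ((*) :: 'b::field \<Rightarrow> 'b \<Rightarrow> 'b)"
  by unfold_locales (simp_all add: algebra_simps)

lemma vector_space_matrix_scale: "vector_space (matrix_scale :: 'b::field \<Rightarrow> 'b^'n^'m \<Rightarrow> 'b^'n^'m)"
  by unfold_locales (simp_all add: matrix_scale_def vec_eq_iff algebra_simps)

lemma vector_space_base_scale:
  assumes "vector_space s"
  shows "vector_space (base_scale s)"
proof -
  interpret vector_space s by fact
  show ?thesis
    by unfold_locales (simp_all add: scale_right_distrib scale_left_distrib)
qed

lemma matrix_scale_1 [simp]: "matrix_scale 1 A = A"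
  by (simp add: matrix_scale_def vec_eq_iff)

lemma matrix_scale_0 [simp]: "matrix_scale 0 A = 0"
  by (simp add: matrix_scale_def vec_eq_iff)

lemma subspace_tangent_space:
  fixes I :: "('n::finite gl_monomial \<Rightarrow>\<^sub>0 'b::field) set"
  shows "module.subspace matrix_scale (tangent_space I)"
proof -
  interpret M: vector_space "matrix_scale :: 'b \<Rightarrow> 'b^'n^'n \<Rightarrow> 'b^'n^'n"
    by (rule vector_space_matrix_scale)
  have comb: "matrix_scale \<alpha> A + matrix_scale \<beta> A' \<in> tangent_space I"
    if "A \<in> tangent_space I" "A' \<in> tangent_space I" for \<alpha> \<beta> A A'
    using that by (simp add: tangent_space_def reg_diff_linear[OF vector_space_mult])
  have zero: "reg_diff (*) p (0 :: 'b^'n^'n) = 0" for p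
    using reg_diff_linear[OF vector_space_mult, of p 0 "0 :: 'b^'n^'n" 0 0] by simp
  show ?thesis
  proof (rule M.subspaceI)
    show "0 \<in> tangent_space I"
      by (simp add: tangent_space_def zero)
    show "x + y \<in> tangent_space I" if "x \<in> tangent_space I" "y \<in> tangent_space I" for x y
      using comb[OF that, of 1 1] by simp
    show "matrix_scale c x \<in> tangent_space I" if "x \<in> tangent_space I" for c x
      using comb[OF that that, of c 0] by simp
  qed
qed

section \<open>Descent of coordinates from K to k\<close>

lemma independent_base_scale:
  assumes "vector_space s" "\<not> module.dependent s B"
  shows "\<not> module.dependent (base_scale s) B"
proof -
  interpret K: vector_space s by fact
  interpret k: vector_space "base_scale s" by (rule vector_space_base_scale) fact
  show ?thesis
    unfolding k.independent_explicit_module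
  proof (intro allI impI)
    fix t u v
    assume "finite t" "t \<subseteq> B" "(\<Sum>v\<in>t. s (to_ac (u v)) v) = 0" "v \<in> t"
    then have "to_ac (u v) = 0"
      by (rule K.independentD[OF assms(2)])
    then show "u v = 0" by simp
  qed
qed

text \<open>The vectors whose coordinate at \<open>b\<close> lies in k form a k-subspace containing
  \<open>B\<close>, hence containing its k-span.\<close>

lemma representation_in_range_to_ac:
  assumes "vector_space s" "\<not> module.dependent s B" "module.span s B = UNIV"
    and "x \<in> module.span (base_scale s) B"
  shows "module.representation s B x b \<in> range to_ac"
proof -
  interpret K: vector_space s by fact
  interpret k: vector_space "base_scale s" by (rule vector_space_base_scale) fact
  have R: "0 \<in> range to_ac" "1 \<in> range to_ac"
    by (metis rangeI to_ac_0, metis rangeI to_ac_1)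
  have "B \<subseteq> {x. K.representation B x b \<in> range to_ac}"
    using R by (auto simp: K.representation_basis[OF assms(2)])
  moreover have "k.subspace {x. K.representation B x b \<in> range to_ac}"
    by (rule k.subspaceI)
       (use R in \<open>auto simp: K.representation_zero K.representation_add[OF assms(2)]
          K.representation_scale[OF assms(2)] assms(3) simp flip: to_ac_add to_ac_mult\<close>)
  ultimately show ?thesis
    using k.span_minimal assms(4) by blast
qed

text \<open>Each coordinate of \<open>p\<close> is a polynomial over k that vanishes on
  \<open>G\<close>, so its differential at \<open>A\<close> is 0 by the definition of
  \<open>lie_algebra\<close>. This makes the derivative of a representation well defined.\<close>

lemma reg_diff_eq_0_of_vanishing:
  assumes V: "k_form s V"
    and pV: "\<And>m. Poly_Mapping.lookup p m \<in> V"
    and p0: "\<And>g. g \<in> G \<Longrightarrow> reg_eval s p g = 0"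
    and A: "A \<in> lie_algebra G"
  shows "reg_diff (base_scale s) p A = 0"
proof -
  obtain B where s: "vector_space s" and B: "\<not> module.dependent s B" "module.span s B = UNIV"
    and VB: "V = module.span (base_scale s) B"
    using V unfolding k_form_def by blast
  interpret K: vector_space s by (rule s)
  let ?d = "reg_diff (base_scale s) p A"
  have "K.representation B ?d b = 0" for b
  proof -
    define h where "h x = K.representation B x b" for x
    have h: "h (x + y) = h x + h y" "h (s c x) = c * h x" for x y c
      by (simp_all add: h_def K.representation_add[OF B(1)] K.representation_scale[OF B(1)] B(2))
    have h0: "h 0 = 0" by (simp add: h_def K.representation_zero)
    \<comment> \<open>\<open>q\<close> is the coordinate of \<open>p\<close> at \<open>b\<close>
      brought down to k; \<open>of_ac\<close> inverts \<open>to_ac\<close> here because the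
      coefficients of \<open>p\<close> lie in \<open>V\<close>.\<close>
    define q where "q = Poly_Mapping.map (\<lambda>x. of_ac (h x)) p"
    have "to_ac (of_ac (h (Poly_Mapping.lookup p m))) = h (Poly_Mapping.lookup p m)" for m
      using representation_in_range_to_ac[OF s B, of "Poly_Mapping.lookup p m" b] pV[of m]
      by (auto simp: h_def VB)
    then have q: "Poly_Mapping.map to_ac q = Poly_Mapping.map h p"
      by (intro poly_mapping_eqI) (auto simp: q_def map.rep_eq when_def h0, metis to_ac_0)
    have "reg_eval (*) (Poly_Mapping.map to_ac q) g = 0" if "g \<in> G" for g
      unfolding q using p0[OF that]
      by (simp add: reg_eval_eq_coeff_sum coeff_sum_map[of h s] h h0)
    then have "q \<in> vanishing_ideal_base G"
      by (simp add: vanishing_ideal_base_def vanishing_ideal_def)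
    then have "reg_diff (*) q A = 0"
      using A by (simp add: lie_algebra_def tangent_space_def)
    \<comment> \<open>The weights of the differential are in k since \<open>A\<close> has entries in
      k, so \<open>to_ac\<close> need only be applied to the coefficients.\<close>
    then have "reg_diff (base_scale (*)) (Poly_Mapping.map to_ac q) A = 0"
      by (simp add: reg_diff_eq_coeff_sum coeff_sum_map[of to_ac "(*)"])
    then show ?thesis
      unfolding q by (simp add: reg_diff_eq_coeff_sum coeff_sum_map[of h "base_scale s"] h flip: h_def)
  qed
  then show ?thesis
    using K.sum_nonzero_representation_eq[OF B(1), of ?d] B(2) by simp
qed

lemma rep_derivative_eq:
  assumes V: "k_form s V" and A: "A \<in> lie_algebra G"
    and p: "regular_over_base s V G p (\<lambda>g. \<rho> g v)"
  shows "rep_derivative s V G \<rho> A v = reg_diff (base_scale s) p A"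
  unfolding rep_derivative_def
proof (rule the_equality)
  show "\<exists>q. regular_over_base s V G q (\<lambda>g. \<rho> g v) \<and>
      reg_diff (base_scale s) p A = reg_diff (base_scale s) q A"
    using p by blast
next
  fix u
  assume "\<exists>q. regular_over_base s V G q (\<lambda>g. \<rho> g v) \<and> u = reg_diff (base_scale s) q A"
  then obtain q where q: "regular_over_base s V G q (\<lambda>g. \<rho> g v)"
    and u: "u = reg_diff (base_scale s) q A" by blast
  obtain B where s: "vector_space s" and VB: "V = module.span (base_scale s) B"
    using V unfolding k_form_def by blast
  interpret K: vector_space s by (rule s)
  interpret k: vector_space "base_scale s" by (rule vector_space_base_scale[OF s])
  have "reg_diff (base_scale s) (q - p) A = 0"
  proof (rule reg_diff_eq_0_of_vanishing[OF V _ _ A])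
    show "Poly_Mapping.lookup (q - p) m \<in> V" for m
      using p q unfolding regular_over_base_def VB lookup_minus by (blast intro: k.span_diff)
    show "reg_eval s (q - p) g = 0" if "g \<in> G" for g
    proof -
      \<comment> \<open>Additivity of \<open>coeff_sum\<close> at \<open>q - p + p = q\<close>
        supplies the rule for differences.\<close>
      have "reg_eval s (q - p + p) g = reg_eval s (q - p) g + reg_eval s p g"
        unfolding reg_eval_eq_coeff_sum
        by (intro coeff_sum_add) (simp_all add: K.scale_right_distrib)
      then show ?thesis
        using p q that unfolding regular_over_base_def by simp
    qed
  qed
  moreover have "reg_diff (base_scale s) (q - p + p) A =
      reg_diff (base_scale s) (q - p) A + reg_diff (base_scale s) p A"
    unfolding reg_diff_eq_coeff_sum
    by (intro coeff_sum_add) (simp_all add: K.scale_right_distrib)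
  ultimately show "u = reg_diff (base_scale s) p A"
    by (simp add: u)
qed

section \<open>The counting formula for a rational representation of a reductive group\<close>

theorem proposition1:
  fixes G :: "('a::{field,finite} alg_closure^'n^'n) set"
    and s :: "'a alg_closure \<Rightarrow> 'w::ab_group_add \<Rightarrow> 'w"
    and V :: "'w set"
    and \<rho> :: "'a alg_closure^'n^'n \<Rightarrow> 'w \<Rightarrow> 'w"
    and \<Psi> :: "'a \<Rightarrow> complex"
    and \<xi> :: "'a^'n^'n \<Rightarrow> 'a"
  defines "\<gg> \<equiv> lie_algebra G"
    and "d\<rho> \<equiv> rep_derivative s V G \<rho>"
  assumes "reductive_group G"
    and "k_form s V"
    and "rational_representation s V G \<rho>"
    and "nontrivial_additive_character \<Psi>"
    and "\<xi> \<in> coadjoint_invariants G"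
  shows
    "of_nat (card {(v, w). v \<in> V \<and> w \<in> dual_space (base_scale s) V \<and> moment_map \<gg> d\<rho> v w = \<xi>})
       = complex_of_real (real (card \<gg>) powr (- 1 / 2)) * of_nat (card V)
           * fourier_transform \<Psi> \<gg> (\<lambda>A. of_nat (kernel_count V d\<rho> A)) \<xi>
     \<and>
     complex_of_real (real (card \<gg>) powr (- 1 / 2)) * of_nat (card V)
         * fourier_transform \<Psi> \<gg> (\<lambda>A. of_nat (kernel_count V d\<rho> A)) \<xi>
       = inverse (of_nat (card \<gg>)) * of_nat (card V)
           * (\<Sum>A\<in>\<gg>. of_nat (kernel_count V d\<rho> A) * \<Psi> (\<xi> A))"
proof -
  obtain B where s: "vector_space s" and B: "finite B" "\<not> module.dependent s B"
    and V: "V = module.span (base_scale s) B"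
    using \<open>k_form s V\<close> unfolding k_form_def by blast
  have ks: "vector_space (base_scale s)" by (rule vector_space_base_scale[OF s])
  interpret k: vector_space "base_scale s" by (rule ks)
  interpret M: vector_space "matrix_scale :: 'a \<Rightarrow> 'a^'n^'n \<Rightarrow> 'a^'n^'n"
    by (rule vector_space_matrix_scale)
  have L: "M.subspace \<gg>"
    unfolding \<gg>_def lie_algebra_def by (rule subspace_tangent_space)
  \<comment> \<open>One \<open>p\<close> serves all \<open>A\<close> at once, so linearity in
    \<open>A\<close> reduces to that of the differential of a single function.\<close>
  have ex: "\<exists>p. (\<forall>m. Poly_Mapping.lookup p m \<in> V) \<and>
      (\<forall>A\<in>\<gg>. d\<rho> A v = reg_diff (base_scale s) p A)" if "v \<in> V" for v
  proof -
    obtain p where p: "regular_over_base s V G p (\<lambda>g. \<rho> g v)"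
      using \<open>rational_representation s V G \<rho>\<close> \<open>v \<in> V\<close>
      unfolding rational_representation_def by blast
    then have "\<forall>A\<in>\<gg>. d\<rho> A v = reg_diff (base_scale s) p A"
      unfolding d\<rho>_def \<gg>_def using rep_derivative_eq[OF \<open>k_form s V\<close>] by blast
    then show ?thesis using p unfolding regular_over_base_def by blast
  qed
  \<comment> \<open>The differential is a k-linear combination of the coefficients of
    \<open>p\<close>, which lie in \<open>V\<close>.\<close>
  have mem: "d\<rho> A v \<in> V" if A: "A \<in> \<gg>" and v: "v \<in> V" for A v
  proof -
    obtain p where "\<And>m. Poly_Mapping.lookup p m \<in> V" "d\<rho> A v = reg_diff (base_scale s) p A"
      using ex[OF v] A by blast
    then show ?thesis
      unfolding reg_diff_def V by (auto intro!: k.span_sum k.span_scale)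
  qed
  have comb: "d\<rho> (matrix_scale \<alpha> A + matrix_scale \<beta> A') v = s (to_ac \<alpha>) (d\<rho> A v) + s (to_ac \<beta>) (d\<rho> A' v)"
    if AA': "A \<in> \<gg>" "A' \<in> \<gg>" and v: "v \<in> V" for \<alpha> \<beta> A A' v
  proof -
    obtain p where p: "\<And>A. A \<in> \<gg> \<Longrightarrow> d\<rho> A v = reg_diff (base_scale s) p A"
      using ex[OF v] by blast
    have "matrix_scale \<alpha> A + matrix_scale \<beta> A' \<in> \<gg>"
      using L AA' by (intro M.subspace_add M.subspace_scale)
    then show ?thesis
      using AA' by (simp only: p reg_diff_linear[OF ks])
  qed
  have add: "d\<rho> (A + A') v = d\<rho> A v + d\<rho> A' v" if "A \<in> \<gg>" "A' \<in> \<gg>" "v \<in> V" for A A' v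
    using comb[OF that, of 1 1] k.scale_one by simp
  have scale: "d\<rho> (matrix_scale c A) v = s (to_ac c) (d\<rho> A v)" if "A \<in> \<gg>" "v \<in> V" for c A v
    using comb[OF that(1) that, of c 0] k.scale_zero_left by simp
  have \<xi>: "\<xi> \<in> dual_space matrix_scale \<gg>"
    using \<open>\<xi> \<in> coadjoint_invariants G\<close> unfolding coadjoint_invariants_def \<gg>_def by blast
  have count: "of_nat (card {(v, w). v \<in> V \<and> w \<in> dual_space (base_scale s) V \<and> moment_map \<gg> d\<rho> v w = \<xi>}) =
      inverse (of_nat (card \<gg>)) * of_nat (card V)
        * (\<Sum>A\<in>\<gg>. of_nat (kernel_count V d\<rho> A) * \<Psi> (\<xi> A))"
    using \<open>nontrivial_additive_character \<Psi>\<close> ks B(1) independent_base_scale[OF s B(2)] V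
      vector_space_matrix_scale L finite mem add scale \<xi>
    by (rule card_moment_map_fibre)
  have "\<gg> \<noteq> {}" using M.subspace_0[OF L] by blast
  then have "real (card \<gg>) > 0" by (simp add: card_gt_0_iff)
  \<comment> \<open>One factor is the explicit normalization, the other is hidden in
    \<open>fourier_transform\<close>.\<close>
  then have "real (card \<gg>) powr (- 1 / 2) * real (card \<gg>) powr (- 1 / 2) = inverse (real (card \<gg>))"
    by (subst powr_add[symmetric]) (simp add: powr_minus)
  then have norm: "complex_of_real (real (card \<gg>) powr (- 1 / 2)) * complex_of_real (real (card \<gg>) powr (- 1 / 2)) =
      inverse (of_nat (card \<gg>))"
    by (metis of_real_inverse of_real_mult of_real_of_nat_eq)
  have "complex_of_real (real (card \<gg>) powr (- 1 / 2)) * of_nat (card V)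
         * fourier_transform \<Psi> \<gg> (\<lambda>A. of_nat (kernel_count V d\<rho> A)) \<xi> =
      complex_of_real (real (card \<gg>) powr (- 1 / 2)) * complex_of_real (real (card \<gg>) powr (- 1 / 2)) * of_nat (card V)
         * (\<Sum>A\<in>\<gg>. of_nat (kernel_count V d\<rho> A) * \<Psi> (\<xi> A))"
    by (simp add: fourier_transform_def mult_ac)
  then show ?thesis using count by (simp only: norm simp_thms)
qed

end
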